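(* Let $q$ be a power of a prime, let $n\ge 3$ and $s\ge 1$ be integers with $\gcd(s,n)=1$, and put $\sigma=q^s$. Let $\delta\in\mathbb F_{q^n}$. If $\mathrm N_{q^n/q}(\delta)=1$, then the Lunardon-Polverino binomial $f_{\sigma,\delta}(x)=x^\sigma+\delta x^{\sigma^{n-1}}$ is not scattered (as a linearized polynomial over $\mathbb F_{q^n}$).
   Context: $\mathbb F_{q^n}$ is the finite field with $q^n$ elements, and $\mathrm N_{q^n/q}(z)=z^{(q^n-1)/(q-1)}$ is the norm over $\mathbb F_q$ of $z\in\mathbb F_{q^n}$. A linearized polynomial $f$ over $\mathbb F_{q^n}$ (an $\mathbb F_q$-linear map $\mathbb F_{q^n}\to\mathbb F_{q^n}$) is called scattered if for any $t,x\in\mathbb F_{q^n}$ the condition $xf(t)-tf(x)=0$ holds if and only if $x$ and $t$ are $\mathbb F_q$-linearly dependent. *)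

theory Defs
  imports "HOL-Number_Theory.Number_Theory" "HOL-Library.Cardinality"
begin

definition is_subfield :: "'a::field set \<Rightarrow> bool" where
  "is_subfield K \<longleftrightarrow> 0 \<in> K \<and> 1 \<in> K \<and>
     (\<forall>a\<in>K. \<forall>b\<in>K. a - b \<in> K \<and> a * b \<in> K) \<and> (\<forall>a\<in>K. inverse a \<in> K)"

(* Dependence of the pair (x, t) as a family, so that (x, x) is dependent; dependence of the
   set {x, t} would differ when x = t. *)
definition lin_dependent :: "'a::field set \<Rightarrow> 'a \<Rightarrow> 'a \<Rightarrow> bool" where
  "lin_dependent K x t \<longleftrightarrow>
     (\<exists>a\<in>K. \<exists>b\<in>K. (a, b) \<noteq> (0, 0) \<and> a * x + b * t = 0)"

(* Linearized polynomials are represented by the maps they induce. The property is meant for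
   K-linear f; linearity is deliberately not a conjunct, since otherwise the negation would hold
   vacuously for maps that are not linear. *)
definition scattered :: "'a::field set \<Rightarrow> ('a \<Rightarrow> 'a) \<Rightarrow> bool" where
  "scattered K f \<longleftrightarrow> (\<forall>t x. x * f t - t * f x = 0 \<longleftrightarrow> lin_dependent K x t)"

(* The norm from the field with q ^ n elements to its subfield with q elements. The division is
   exact. *)
definition field_norm :: "nat \<Rightarrow> nat \<Rightarrow> 'a::field \<Rightarrow> 'a" where
  "field_norm q n z = z ^ ((q ^ n - 1) div (q - 1))"

definition LP_binomial :: "nat \<Rightarrow> nat \<Rightarrow> 'a::field \<Rightarrow> 'a \<Rightarrow> 'a" where
  "LP_binomial n \<sigma> \<delta> x = x ^ \<sigma> + \<delta> * x ^ (\<sigma> ^ (n - 1))"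

end

theory Submission
  imports Defs "HOL-Computational_Algebra.Polynomial" "HOL-Library.Product_Plus"
begin

text \<open>
  Put \<open>a = v ^ \<sigma> - v\<close>. For \<open>t = u ^ \<sigma>\<close> and \<open>x = (u * v) ^ \<sigma>\<close> the condition
  \<open>x * f t = t * f x\<close> on the binomial \<open>f\<close> collapses to
  \<open>\<delta> * u * a = u ^ (\<sigma> * \<sigma>) * a ^ \<sigma>\<close>. With \<open>r = 1 / u\<close> and \<open>d = a / r ^ (\<sigma> + 1)\<close> this says
  precisely that \<open>\<delta> = d ^ (\<sigma> - 1)\<close>, and \<open>x\<close>, \<open>t\<close> are independent over \<open>Fq\<close> as soon as \<open>a \<noteq> 0\<close>.

  This computation is reversed to produce the witnesses. Since \<open>\<sigma>\<close> generates the Galois group,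
  norm one gives \<open>d\<close> with \<open>\<delta> = d ^ (\<sigma> - 1)\<close> (\<open>multiplicative_Hilbert_90\<close>). It remains
  to find \<open>r \<noteq> 0\<close> for which \<open>d * r ^ (\<sigma> + 1)\<close> has the form \<open>v ^ \<sigma> - v\<close>; by
  \<open>additive_Hilbert_90\<close> this only requires its trace to vanish. But
  \<open>r \<mapsto> Tr (d * r ^ (\<sigma> + 1))\<close> is a quadratic form in \<open>n\<close> variables over \<open>Fq\<close>, and a quadratic
  form in at least three variables over a finite field represents zero nontrivially
  (\<open>quadratic_form_has_isotropic_vector\<close>). This is where \<open>n \<ge> 3\<close> enters.

  Both forms of Hilbert 90 are obtained by counting: the size of the kernel bounds the image of the map in
  question from below, and the image lies in the zero set of a polynomial whose degree matches this
  bound.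
\<close>

section \<open>Counting fibres\<close>

lemma card_le_fibre_bound_times_card_image:
  assumes "finite A" and "\<And>y. y \<in> f ` A \<Longrightarrow> card {x \<in> A. f x = y} \<le> m"
  shows "card A \<le> m * card (f ` A)"
proof -
  have "A = (\<Union>y\<in>f ` A. {x \<in> A. f x = y})"
    by blast
  then have "card A \<le> (\<Sum>y\<in>f ` A. card {x \<in> A. f x = y})"
    using card_UN_le[of "f ` A" "\<lambda>y. {x \<in> A. f x = y}"] assms(1) by simp
  also have "\<dots> \<le> (\<Sum>y\<in>f ` A. m)"
    by (rule sum_mono) (rule assms(2))
  finally show ?thesis
    by (simp add: mult.commute)
qed

lemma card_UNIV_le_card_kernel_times_card_range:
  fixes g :: "'a::{ab_group_add, finite} \<Rightarrow> 'b::ab_group_add"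
  assumes add: "\<And>x y. g (x + y) = g x + g y"
  shows "CARD('a) \<le> card {x. g x = 0} * card (range g)"
proof (rule card_le_fibre_bound_times_card_image)
  fix y assume "y \<in> range g"
  then obtain x0 where y: "y = g x0"
    by blast
  have "{x \<in> UNIV. g x = y} \<subseteq> (\<lambda>k. k + x0) ` {x. g x = 0}"
  proof
    fix x assume "x \<in> {x \<in> UNIV. g x = y}"
    then have "g (x - x0) = 0"
      using add[of "x - x0" x0] y by simp
    then show "x \<in> (\<lambda>k. k + x0) ` {x. g x = 0}"
      by (intro image_eqI[of _ _ "x - x0"]) auto
  qed
  then have "card {x \<in> UNIV. g x = y} \<le> card ((\<lambda>k. k + x0) ` {x. g x = 0})"
    by (intro card_mono) auto
  also have "\<dots> \<le> card {x. g x = 0}"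
    by (rule card_image_le) simp
  finally show "card {x \<in> UNIV. g x = y} \<le> card {x. g x = 0}" .
qed simp

section \<open>Isotropic vectors of quadratic forms over a finite field\<close>

lemma
  assumes "is_subfield K"
  shows subfield_zero: "0 \<in> K" and subfield_one: "1 \<in> K"
    and subfield_diff: "a \<in> K \<Longrightarrow> b \<in> K \<Longrightarrow> a - b \<in> K"
    and subfield_uminus: "a \<in> K \<Longrightarrow> - a \<in> K"
    and subfield_add: "a \<in> K \<Longrightarrow> b \<in> K \<Longrightarrow> a + b \<in> K"
    and subfield_mult: "a \<in> K \<Longrightarrow> b \<in> K \<Longrightarrow> a * b \<in> K"
    and subfield_inverse: "a \<in> K \<Longrightarrow> inverse a \<in> K"
    and subfield_divide: "a \<in> K \<Longrightarrow> b \<in> K \<Longrightarrow> a / b \<in> K"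
proof -
  note K = assms[unfolded is_subfield_def]
  show z: "0 \<in> K" and "1 \<in> K" and d: "\<And>a b. a \<in> K \<Longrightarrow> b \<in> K \<Longrightarrow> a - b \<in> K"
    and m: "\<And>a b. a \<in> K \<Longrightarrow> b \<in> K \<Longrightarrow> a * b \<in> K" and i: "\<And>a. a \<in> K \<Longrightarrow> inverse a \<in> K"
    using K by blast+
  show u: "- a \<in> K" if "a \<in> K" for a
    using d[OF z that] by simp
  show "a + b \<in> K" if "a \<in> K" "b \<in> K" for a b
    using d[OF that(1) u[OF that(2)]] by simp
  show "a / b \<in> K" if "a \<in> K" "b \<in> K" for a b
    using m[OF that(1) i[OF that(2)]] by (simp add: divide_inverse)
qed

lemma card_subfield_ge_2:
  assumes "is_subfield (K :: 'a::{field, finite} set)"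
  shows "2 \<le> card K"
proof -
  have "card {0, 1 :: 'a} \<le> card K"
    using subfield_zero[OF assms] subfield_one[OF assms] by (intro card_mono) auto
  then show ?thesis
    by simp
qed

text \<open>
  Squaring is at most two-to-one on the units, and zero is a further square. The strict inequality
  is what makes the pigeonhole argument below work.
\<close>

lemma card_squares_gt_half:
  fixes K :: "'a::{field, finite} set"
  assumes K: "is_subfield K"
  shows "card K < 2 * card ((\<lambda>a. a\<^sup>2) ` K)"
proof -
  let ?sq = "\<lambda>a :: 'a. a\<^sup>2"
  have "card {x \<in> K - {0}. x\<^sup>2 = y} \<le> 2" if y: "y \<in> ?sq ` (K - {0})" for y
  proof -
    obtain a where "y = a\<^sup>2"
      using y by blast
    then have "{x \<in> K - {0}. x\<^sup>2 = y} \<subseteq> {a, - a}"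
      by (auto simp: power2_eq_iff)
    then have "card {x \<in> K - {0}. x\<^sup>2 = y} \<le> card {a, - a}"
      by (intro card_mono) auto
    also have "\<dots> \<le> 2"
      by (simp add: card_insert_if)
    finally show ?thesis .
  qed
  then have "card (K - {0}) \<le> 2 * card (?sq ` (K - {0}))"
    by (intro card_le_fibre_bound_times_card_image) auto
  moreover have "?sq ` K = insert 0 (?sq ` (K - {0}))"
    using subfield_zero[OF K] by (auto simp: image_iff)
  moreover have "0 \<notin> ?sq ` (K - {0})"
    by auto
  ultimately show ?thesis
    using subfield_zero[OF K] by (simp add: card_Diff_singleton)
qed

text \<open>
  The values \<open>A * a\<^sup>2\<close> and the values \<open>C - B * b\<^sup>2\<close> each fill more than half of \<open>K\<close>, so they
  have one in common.
\<close>

lemma binary_diagonal_form_surjective: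
  fixes K :: "'a::{field, finite} set"
  assumes K: "is_subfield K" and "A \<in> K" "B \<in> K" "C \<in> K" and "A \<noteq> 0" "B \<noteq> 0"
  obtains a b where "a \<in> K" "b \<in> K" "A * a\<^sup>2 + B * b\<^sup>2 = C"
proof -
  let ?S = "(\<lambda>a. a\<^sup>2) ` K"
  let ?X = "(\<lambda>s. A * s) ` ?S" and ?Y = "(\<lambda>s. C - B * s) ` ?S"
  have sub: "?X \<union> ?Y \<subseteq> K"
    using assms by (auto simp: power2_eq_square intro!: subfield_diff[OF K] subfield_mult[OF K])
  have "card ?X = card ?S" "card ?Y = card ?S"
    using assms by (auto intro!: card_image inj_onI)
  then have "card K < card ?X + card ?Y"
    using card_squares_gt_half[OF K] by linarith
  moreover have "card (?X \<union> ?Y) \<le> card K"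
    using sub by (intro card_mono) auto
  ultimately have "?X \<inter> ?Y \<noteq> {}"
    using card_Un_disjoint[of ?X ?Y] by force
  then obtain a b where "a \<in> K" "b \<in> K" "A * a\<^sup>2 = C - B * b\<^sup>2"
    by blast
  then show thesis
    by (intro that[of a b]) auto
qed

text \<open>
  The whole field serves as the space of vectors, and the bound on its cardinality says that its
  dimension over \<open>K\<close> is at least three. If \<open>2 \<noteq> 0\<close>, orthogonalise: on three mutually orthogonal
  vectors \<open>1, y, z\<close> the form is diagonal, and \<open>binary_diagonal_form_surjective\<close> solves
  \<open>Q (a + b * y + z) = 0\<close>. If \<open>2 = 0\<close>, the polar form \<open>B\<close> is alternating and
  diagonalisation can fail, but every element of \<open>K\<close> is a square, so
  two independent vectors orthogonal to each other are enough. In both cases the orthogonal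
  vectors exist because a linear map to \<open>K\<close> or to \<open>K \<times> K\<close> has a large kernel.
\<close>

lemma quadratic_form_has_isotropic_vector:
  fixes K :: "'a::{field, finite} set" and Q :: "'a \<Rightarrow> 'a" and B :: "'a \<Rightarrow> 'a \<Rightarrow> 'a"
  assumes K: "is_subfield K" and card: "card K ^ 3 \<le> CARD('a)"
    and QK: "\<And>x. Q x \<in> K"
    and Q_scale: "\<And>c x. c \<in> K \<Longrightarrow> Q (c * x) = c\<^sup>2 * Q x"
    and Q_add: "\<And>x y. Q (x + y) = Q x + Q y + B x y"
    and B_add: "\<And>x y z. B x (y + z) = B x y + B x z"
    and B_scale: "\<And>c x y. c \<in> K \<Longrightarrow> B x (c * y) = c * B x y"
  obtains x where "x \<noteq> 0" "Q x = 0"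
proof -
  note K_closed = subfield_one[OF K] subfield_add[OF K] subfield_diff[OF K]
    subfield_uminus[OF K] subfield_mult[OF K] subfield_divide[OF K]
  have B_eq: "B x y = Q (x + y) - Q x - Q y" for x y
    by (simp add: Q_add)
  have B_sym: "B x y = B y x" for x y
    by (simp add: B_eq add.commute)
  have BK: "B x y \<in> K" for x y
    unfolding B_eq by (intro K_closed QK)
  have B_scale': "B (c * x) y = c * B x y" if "c \<in> K" for c x y
    using B_scale[OF that] by (simp add: B_sym[of _ y])
  have B_add': "B (x + y) z = B x z + B y z" for x y z
    by (simp add: B_sym[of _ z] B_add)
  have q2: "2 \<le> card K"
    by (rule card_subfield_ge_2[OF K])
  have "\<exists>x. x \<noteq> 0 \<and> Q x = 0"
  proof (rule ccontr)
    assume "\<not> ?thesis"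
    then have aniso: "x = 0" if "Q x = 0" for x
      using that by blast
    then have Q1: "Q 1 \<noteq> 0"
      by fastforce
    show False
    proof (cases "(2 :: 'a) = 0")
      case True
      have "inj_on (\<lambda>a :: 'a. a\<^sup>2) K"
      proof (rule inj_onI)
        fix a b :: 'a assume "a\<^sup>2 = b\<^sup>2"
        moreover have "- b = b"
          using True by (metis add_eq_0_iff mult_2 mult_zero_left)
        ultimately show "a = b"
          by (auto simp: power2_eq_iff)
      qed
      then have sq: "(\<lambda>a. a\<^sup>2) ` K = K"
        using K_closed(5) by (intro endo_inj_surj) (auto simp: power2_eq_square)
      have "card K * (card K * card K) \<le> card {x. B 1 x = 0} * card (range (B 1))"
        using card card_UNIV_le_card_kernel_times_card_range[of "B 1"] B_add
        by (simp add: power3_eq_cube)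
      also have "\<dots> \<le> card {x. B 1 x = 0} * card K"
        using BK by (intro mult_left_mono card_mono) auto
      finally have "card K * card K \<le> card {x. B 1 x = 0}"
        using q2 by simp
      moreover have "card K < card K * card K"
        using q2 by simp
      ultimately have "\<not> card {x. B 1 x = 0} \<le> card K"
        by linarith
      then have "\<not> {x. B 1 x = 0} \<subseteq> K"
        using card_mono[of K] by auto
      then obtain z where z: "B 1 z = 0" "z \<notin> K"
        by blast
      have "- Q z / Q 1 \<in> (\<lambda>a. a\<^sup>2) ` K"
        using subfield_divide[OF K subfield_uminus[OF K QK[of z]] QK[of 1]] unfolding sq .
      then obtain a where a: "- Q z / Q 1 = a\<^sup>2" "a \<in> K"
        by (rule imageE)
      have "Q (a + z) = 0"
        using Q_scale[OF a(2), of 1] B_scale'[OF a(2), of 1 z] a(1)[symmetric] z(1) Q1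
        by (simp add: Q_add)
      then have "z = - a"
        using aniso by (metis add_eq_0_iff)
      then show False
        using z(2) K_closed(4)[OF a(2)] by simp
    next
      case False
      have B_self: "B x x = 2 * Q x" for x
      proof -
        have "Q (x + x) = 4 * Q x"
          using Q_scale[of 2 x] K_closed(2)[OF K_closed(1,1)] by (simp add: mult_2[symmetric])
        then show ?thesis
          by (simp add: B_eq)
      qed
      have orth: "\<exists>z. z \<noteq> 0 \<and> B x z = 0 \<and> B y z = 0" for x y
      proof (rule ccontr)
        assume no: "\<not> ?thesis"
        let ?g = "\<lambda>z. (B x z, B y z)"
        have "{z. ?g z = 0} \<subseteq> {0}"
          using no by (auto simp: zero_prod_def)
        then have "card {z. ?g z = 0} \<le> 1"
          using card_mono[of "{0 :: 'a}" "{z. ?g z = 0}"] by simp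
        moreover have "card (range ?g) \<le> card (K \<times> K)"
          using BK by (intro card_mono) auto
        ultimately have "card {z. ?g z = 0} * card (range ?g) \<le> 1 * (card K * card K)"
          by (intro mult_mono) (auto simp: card_cartesian_product)
        moreover have "CARD('a) \<le> card {z. ?g z = 0} * card (range ?g)"
          by (rule card_UNIV_le_card_kernel_times_card_range) (simp add: B_add)
        ultimately have "card K * (card K * card K) \<le> card K * card K"
          using card unfolding power3_eq_cube mult_1 mult.assoc by (meson order_trans)
        then show False
          using q2 by simp
      qed
      obtain y where y: "y \<noteq> 0" "B 1 y = 0"
        using orth by blast
      obtain z where z: "z \<noteq> 0" "B 1 z = 0" "B y z = 0"
        using orth by blast
      obtain a b where ab: "a \<in> K" "b \<in> K" "Q 1 * a\<^sup>2 + Q y * b\<^sup>2 = - Q z"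
        using binary_diagonal_form_surjective[OF K QK[of 1] QK[of y] K_closed(4)[OF QK[of z]] Q1]
          aniso y(1) by blast
      (* Independence of 1, y, z need not be known in advance: if ?w vanished, pairing it with z
         would give 2 * Q z = 0. *)
      let ?w = "a + b * y + z"
      have "Q ?w = Q 1 * a\<^sup>2 + Q y * b\<^sup>2 + Q z"
        using Q_scale[OF ab(1), of 1] Q_scale[OF ab(2), of y] B_scale'[OF ab(1), of 1]
          B_scale[OF ab(2)] B_scale'[OF ab(2)] y z
        by (simp add: Q_add B_add')
      then have "?w = 0"
        using ab(3) aniso by simp
      then have "B z ?w = 0"
        using B_scale[of 0 z 0] subfield_zero[OF K] by simp
      moreover have "B z ?w = 2 * Q z"
        using B_scale[OF ab(1), of z 1] B_scale[OF ab(2), of z y] B_sym[of z 1] B_sym[of z y] z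
        by (simp add: B_add B_self)
      ultimately show False
        using False aniso z(1) by simp
    qed
  qed
  then show thesis
    using that by blast
qed

section \<open>Norm and trace in an extension of finite fields\<close>

text \<open>
  Multiplication by a unit \<open>x\<close> of \<open>K\<close> permutes the units, so it leaves their product unchanged.
\<close>

lemma subfield_power_card:
  fixes K :: "'a::{field, finite} set"
  assumes K: "is_subfield K" and x: "x \<in> K"
  shows "x ^ card K = x"
proof (cases "x = 0")
  case False
  have "(\<Prod>y\<in>K - {0}. x * y) = (\<Prod>y\<in>K - {0}. y)"
    by (rule prod.reindex_bij_witness[of _ "\<lambda>y. y / x" "\<lambda>y. x * y"])
      (use False x in \<open>auto intro: subfield_mult[OF K] subfield_divide[OF K]\<close>)
  then have "x ^ card (K - {0}) = 1"
    by (simp add: prod.distrib)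
  moreover have "card K = Suc (card (K - {0}))"
    by (intro card.remove) (auto intro: subfield_zero[OF K])
  ultimately show ?thesis
    by simp
qed (use card_subfield_ge_2[OF K] in simp)

locale finite_field_extension =
  fixes q n :: nat and Fq :: "'a::{field, finite} set"
  assumes primepow_q: "primepow q" and n_pos: "n > 0"
    and card_UNIV: "CARD('a) = q ^ n"
    and subfield_Fq: "is_subfield Fq" and card_Fq: "card Fq = q"
begin

lemma q_ge_2: "2 \<le> q"
  using card_subfield_ge_2[OF subfield_Fq] card_Fq by simp

lemma
  shows power_q_add: "(x + y :: 'a) ^ q ^ k = x ^ q ^ k + y ^ q ^ k"
    and power_q_sum: "(\<Sum>i\<in>I. f i :: 'a) ^ q ^ k = (\<Sum>i\<in>I. f i ^ q ^ k)"
proof -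
  obtain p m where p: "prime p" "q = p ^ m"
    using primepow_q by (auto simp: primepow_def)
  have pr: "prime CHAR('a)"
    by (intro prime_CHAR_semidom finite_imp_CHAR_pos) simp
  have "CHAR('a) dvd p ^ (m * n)"
    using CHAR_dvd_CARD[where ?'a = 'a] by (simp add: card_UNIV p(2) power_mult)
  then have "CHAR('a) = p"
    using pr p(1) by (metis prime_dvd_power primes_dvd_imp_eq)
  then have "q ^ k = CHAR('a) ^ (m * k)"
    by (simp add: p(2) power_mult)
  then show "(x + y) ^ q ^ k = x ^ q ^ k + y ^ q ^ k"
    and "(\<Sum>i\<in>I. f i) ^ q ^ k = (\<Sum>i\<in>I. f i ^ q ^ k)"
    using pr by (auto intro: freshmans_dream' freshmans_dream_sum')
qed

lemma power_q_diff: "(x - y :: 'a) ^ q ^ k = x ^ q ^ k - y ^ q ^ k"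
  using power_q_add[of "x - y" y k] by simp

lemma fixed_power_iterate:
  assumes "(x :: 'a) ^ m = x"
  shows "x ^ m ^ k = x"
  using assms by (induction k) (simp_all add: power_mult)

lemma power_q_n: "(x :: 'a) ^ q ^ n = x"
  using subfield_power_card[of "UNIV :: 'a set" x] by (simp add: is_subfield_def card_UNIV)

text \<open>
  All \<open>q\<close> elements of \<open>Fq\<close> are roots of \<open>X ^ q - X\<close>, which has no room for other roots.
\<close>

lemma in_Fq_iff: "x \<in> Fq \<longleftrightarrow> x ^ q = x"
proof -
  let ?p = "monom 1 q - monom 1 1 :: 'a poly"
  have "coeff ?p q = 1"
    using q_ge_2 by simp
  then have nz: "?p \<noteq> 0"
    by (metis coeff_0 zero_neq_one)
  have "{x. poly ?p x = 0} = {x. x ^ q = x}"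
    by (auto simp: poly_monom)
  then have "card {x :: 'a. x ^ q = x} \<le> degree ?p"
    using card_poly_roots_bound[OF nz] by simp
  also have "\<dots> \<le> q"
    using q_ge_2 by (intro degree_diff_le order_trans[OF degree_monom_le]) auto
  finally have "card {x :: 'a. x ^ q = x} \<le> card Fq"
    by (simp add: card_Fq)
  moreover have "Fq \<subseteq> {x. x ^ q = x}"
    using subfield_power_card[OF subfield_Fq] by (auto simp: card_Fq)
  ultimately have "Fq = {x. x ^ q = x}"
    by (intro card_seteq) auto
  then show ?thesis
    by blast
qed

lemma Fq_power_q: "x \<in> Fq \<Longrightarrow> x ^ q ^ k = x"
  using in_Fq_iff fixed_power_iterate by blast

text \<open>
  Bezout coefficients with \<open>s * a = n * b + 1\<close> turn the \<open>a\<close>-fold iterate of \<open>x \<mapsto> x ^ q ^ s\<close>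
  into \<open>x \<mapsto> x ^ q\<close>, because \<open>x \<mapsto> x ^ q ^ n\<close> is the identity.
\<close>

lemma fixed_field_of_Frobenius_generator:
  assumes "coprime s n" and "s > 0"
  shows "x ^ q ^ s = x \<longleftrightarrow> x \<in> Fq"
proof
  assume fix_s: "x ^ q ^ s = x"
  obtain a b where ab: "s * a = n * b + 1"
    using bezout_nat[of s n] assms by (metis coprime_imp_gcd_eq_1 less_not_refl)
  have "x = x ^ q ^ (s * a)"
    using fixed_power_iterate[OF fix_s] by (simp add: power_mult)
  also have "\<dots> = (x ^ (q ^ n) ^ b) ^ q"
    unfolding ab power_add by (simp add: power_mult[symmetric] mult.commute)
  also have "\<dots> = x ^ q"
    using fixed_power_iterate[OF power_q_n] by simp
  finally show "x \<in> Fq"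
    by (simp add: in_Fq_iff)
qed (rule Fq_power_q)

lemma norm_exponent: "(q - 1) * ((q ^ n - 1) div (q - 1)) = q ^ n - 1"
proof -
  have "[q ^ n = 1 ^ n] (mod (q - 1))"
    using q_ge_2 by (intro cong_pow) (simp add: cong_altdef_nat)
  then have "(q - 1) dvd (q ^ n - 1)"
    using q_ge_2 by (simp add: cong_altdef_nat)
  then show ?thesis
    by simp
qed

text \<open>
  The homomorphism \<open>x \<mapsto> x ^ q ^ s / x\<close> on the units has kernel \<open>Fq - {0}\<close>, so its image has at
  least \<open>m = (q ^ n - 1) / (q - 1)\<close> elements. They all have norm one, that is, they are among the at
  most \<open>m\<close> roots of \<open>X ^ m - 1\<close>; hence every element of norm one is attained.
\<close>

lemma multiplicative_Hilbert_90:
  assumes s: "coprime s n" "s > 0" and norm: "field_norm q n (\<delta> :: 'a) = 1"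
  obtains d where "d \<noteq> 0" "d ^ q ^ s = \<delta> * d"
proof -
  define m where "m = (q ^ n - 1) div (q - 1)"
  have qm: "(q - 1) * m = q ^ n - 1"
    unfolding m_def by (rule norm_exponent)
  have qn: "1 < q ^ n"
    using q_ge_2 n_pos by (intro one_less_power) auto
  then have "m > 0"
    using qm by (cases m) auto
  let ?h = "\<lambda>x :: 'a. x ^ q ^ s / x" and ?U = "UNIV - {0 :: 'a}"
  have "card ?U \<le> (q - 1) * card (?h ` ?U)"
  proof (rule card_le_fibre_bound_times_card_image)
    fix y assume "y \<in> ?h ` ?U"
    then obtain x0 where x0: "x0 \<noteq> 0" "y = ?h x0"
      by blast
    have "{x \<in> ?U. ?h x = y} \<subseteq> (\<lambda>c. c * x0) ` (Fq - {0})"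
    proof
      fix x assume "x \<in> {x \<in> ?U. ?h x = y}"
      then have x: "x \<noteq> 0" "(x / x0) ^ q ^ s = x / x0"
        using x0 by (auto simp: field_simps)
      then have "x / x0 \<in> Fq"
        using fixed_field_of_Frobenius_generator[OF s] by blast
      then show "x \<in> (\<lambda>c. c * x0) ` (Fq - {0})"
        using x x0 by (intro image_eqI[of _ _ "x / x0"]) auto
    qed
    then have "card {x \<in> ?U. ?h x = y} \<le> card ((\<lambda>c. c * x0) ` (Fq - {0}))"
      by (intro card_mono) auto
    also have "\<dots> \<le> card (Fq - {0})"
      by (rule card_image_le) simp
    also have "\<dots> = q - 1"
      using subfield_zero[OF subfield_Fq] by (simp add: card_Fq)
    finally show "card {x \<in> ?U. ?h x = y} \<le> q - 1" .
  qed simp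
  then have "(q - 1) * m \<le> (q - 1) * card (?h ` ?U)"
    unfolding qm by (simp add: card_Diff_singleton card_UNIV)
  then have "m \<le> card (?h ` ?U)"
    using q_ge_2 by simp
  moreover have "card {z :: 'a. z ^ m = 1} \<le> m"
  proof -
    let ?p = "monom 1 m - 1 :: 'a poly"
    have "coeff ?p m = 1"
      using \<open>m > 0\<close> by simp
    then have nz: "?p \<noteq> 0"
      by (metis coeff_0 zero_neq_one)
    have "{z. poly ?p z = 0} = {z. z ^ m = 1}"
      by (auto simp: poly_monom)
    then have "card {z :: 'a. z ^ m = 1} \<le> degree ?p"
      using card_poly_roots_bound[OF nz] by simp
    also have "\<dots> \<le> m"
      by (intro degree_diff_le degree_monom_le) simp
    finally show ?thesis .
  qed
  moreover have "?h ` ?U \<subseteq> {z. z ^ m = 1}"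
  proof clarify
    fix x :: 'a assume x: "x \<noteq> 0"
    have "(x ^ m) ^ (q - 1) * x = x ^ Suc (q ^ n - 1)"
      unfolding power_mult[symmetric] mult.commute[of m] qm by simp
    also have "\<dots> = x"
      using qn by (metis Suc_diff_1 order.strict_trans power_q_n zero_less_one)
    finally have "(x ^ m) ^ (q - 1) = 1"
      using x by simp
    then have "(x ^ m) ^ Suc (q - 1) = x ^ m"
      by simp
    then have "(x ^ m) ^ q = x ^ m"
      using q_ge_2 by simp
    then have "(x ^ m) ^ q ^ s = x ^ m"
      by (rule fixed_power_iterate)
    then show "?h x ^ m = 1"
      using x by (simp add: power_divide power_mult[symmetric] mult.commute)
  qed
  ultimately have "?h ` ?U = {z. z ^ m = 1}"
    by (intro card_seteq) auto
  moreover have "\<delta> ^ m = 1"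
    using norm by (simp add: field_norm_def m_def)
  ultimately obtain d where "d \<noteq> 0" "\<delta> = ?h d"
    by blast
  then show thesis
    by (intro that[of d]) auto
qed

text \<open>
  The trace is written with powers of \<open>q\<close> rather than of \<open>q ^ s\<close>: the sum over the Galois group
  is the same, and this ordering shows it as a polynomial of degree \<open>q ^ (n - 1)\<close>.
\<close>

definition field_trace :: "'a \<Rightarrow> 'a" where
  "field_trace x = (\<Sum>i<n. x ^ q ^ i)"

lemma field_trace_add: "field_trace (x + y) = field_trace x + field_trace y"
  by (simp add: field_trace_def power_q_add sum.distrib)

lemma field_trace_diff: "field_trace (x - y) = field_trace x - field_trace y"
  by (simp add: field_trace_def power_q_diff sum_subtractf)

lemma field_trace_scale: "c \<in> Fq \<Longrightarrow> field_trace (c * x) = c * field_trace x"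
  by (simp add: field_trace_def power_mult_distrib Fq_power_q sum_distrib_left)

lemma field_trace_power_q: "field_trace x ^ q ^ k = field_trace (x ^ q ^ k)"
  unfolding field_trace_def power_q_sum by (simp add: power_mult[symmetric] mult.commute)

lemma field_trace_in_Fq: "field_trace x \<in> Fq"
proof -
  have "field_trace x ^ q = (\<Sum>i<n. x ^ q ^ Suc i)"
    using field_trace_power_q[of x 1]
    by (simp add: field_trace_def power_mult[symmetric] mult.commute)
  also have "\<dots> = field_trace x + x ^ q ^ n - x"
    using sum.lessThan_Suc_shift[of "\<lambda>i. x ^ q ^ i" n] by (simp add: field_trace_def)
  finally show ?thesis
    by (simp add: in_Fq_iff power_q_n)
qed

text \<open>
  The map \<open>x \<mapsto> x ^ q ^ s - x\<close> has kernel \<open>Fq\<close>, so its image has at least \<open>q ^ (n - 1)\<close> elements.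
  It consists of elements of trace zero, and as roots of the trace polynomial there are at most
  \<open>q ^ (n - 1)\<close> of those.
\<close>

lemma additive_Hilbert_90:
  assumes s: "coprime s n" "s > 0" and tr: "field_trace a = 0"
  obtains v where "v ^ q ^ s - v = a"
proof -
  let ?g = "\<lambda>x :: 'a. x ^ q ^ s - x"
  have qn: "q ^ n = q * q ^ (n - 1)"
    using n_pos by (cases n) auto
  have "CARD('a) \<le> card {x. ?g x = 0} * card (range ?g)"
    by (rule card_UNIV_le_card_kernel_times_card_range) (simp add: power_q_add)
  also have "{x. ?g x = 0} = Fq"
    using fixed_field_of_Frobenius_generator[OF s] by auto
  finally have "q ^ (n - 1) \<le> card (range ?g)"
    using q_ge_2 by (simp add: card_UNIV card_Fq qn)
  moreover have "card {x. field_trace x = 0} \<le> q ^ (n - 1)"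
  proof -
    let ?p = "\<Sum>i<n. monom 1 (q ^ i) :: 'a poly"
    have "coeff ?p (q ^ (n - 1)) = (\<Sum>i<n. if i = n - 1 then 1 else 0)"
      using q_ge_2 by (auto simp: coeff_sum intro!: sum.cong)
    also have "\<dots> = 1"
      using n_pos by simp
    finally have nz: "?p \<noteq> 0"
      by (metis coeff_0 zero_neq_one)
    have "{x. poly ?p x = 0} = {x. field_trace x = 0}"
      by (auto simp: poly_monom poly_sum field_trace_def)
    then have "card {x. field_trace x = 0} \<le> degree ?p"
      using card_poly_roots_bound[OF nz] by simp
    also have "\<dots> \<le> q ^ (n - 1)"
      using q_ge_2
      by (intro degree_sum_le order_trans[OF degree_monom_le] power_increasing) auto
    finally show ?thesis .
  qed
  moreover have "range ?g \<subseteq> {x. field_trace x = 0}"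
    using Fq_power_q[OF field_trace_in_Fq]
    by (auto simp: field_trace_diff field_trace_power_q[symmetric])
  ultimately have "range ?g = {x. field_trace x = 0}"
    by (intro card_seteq) auto
  then show thesis
    using tr that by (metis (mono_tags, lifting) imageE mem_Collect_eq)
qed

section \<open>The witnesses against scatteredness\<close>

text \<open>
  Since \<open>c ^ q ^ s = c\<close> on \<open>Fq\<close>, the map \<open>r \<mapsto> r ^ (q ^ s + 1)\<close> is the product of two
  \<open>Fq\<close>-linear maps, and composing with the linear functional \<open>z \<mapsto> Tr (d * z)\<close> gives a quadratic form.
\<close>

lemma trace_form_has_isotropic_vector:
  assumes "n \<ge> 3"
  obtains r where "r \<noteq> 0" "field_trace (d * r ^ (q ^ s + 1)) = 0"
proof (rule quadratic_form_has_isotropic_vector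
    [where Q = "\<lambda>r. field_trace (d * r ^ (q ^ s + 1))"
      and B = "\<lambda>r t. field_trace (d * (r ^ q ^ s * t + r * t ^ q ^ s))"])
  show "is_subfield Fq"
    by (rule subfield_Fq)
  show "card Fq ^ 3 \<le> CARD('a)"
    using assms q_ge_2 by (simp add: card_Fq card_UNIV power_increasing)
next
  fix c x assume c: "c \<in> Fq"
  have "d * (c * x) ^ (q ^ s + 1) = c\<^sup>2 * (d * x ^ (q ^ s + 1))"
    by (simp add: power_mult_distrib Fq_power_q[OF c] power2_eq_square)
  moreover have "c\<^sup>2 \<in> Fq"
    using c by (simp add: power2_eq_square subfield_mult[OF subfield_Fq])
  ultimately show "field_trace (d * (c * x) ^ (q ^ s + 1)) = c\<^sup>2 * field_trace (d * x ^ (q ^ s + 1))"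
    by (simp only: field_trace_scale)
next
  fix c x y assume c: "c \<in> Fq"
  have "d * (x ^ q ^ s * (c * y) + x * (c * y) ^ q ^ s) = c * (d * (x ^ q ^ s * y + x * y ^ q ^ s))"
    by (simp add: power_mult_distrib Fq_power_q[OF c] algebra_simps)
  then show "field_trace (d * (x ^ q ^ s * (c * y) + x * (c * y) ^ q ^ s))
      = c * field_trace (d * (x ^ q ^ s * y + x * y ^ q ^ s))"
    by (simp only: field_trace_scale[OF c])
next
  fix x y
  have "d * (x + y) ^ (q ^ s + 1)
      = d * x ^ (q ^ s + 1) + d * y ^ (q ^ s + 1) + d * (x ^ q ^ s * y + x * y ^ q ^ s)"
    by (simp add: power_q_add algebra_simps)
  then show "field_trace (d * (x + y) ^ (q ^ s + 1))
      = field_trace (d * x ^ (q ^ s + 1)) + field_trace (d * y ^ (q ^ s + 1))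
        + field_trace (d * (x ^ q ^ s * y + x * y ^ q ^ s))"
    by (simp only: field_trace_add)
next
  fix x y z
  have "d * (x ^ q ^ s * (y + z) + x * (y + z) ^ q ^ s)
      = d * (x ^ q ^ s * y + x * y ^ q ^ s) + d * (x ^ q ^ s * z + x * z ^ q ^ s)"
    by (simp add: power_q_add algebra_simps)
  then show "field_trace (d * (x ^ q ^ s * (y + z) + x * (y + z) ^ q ^ s))
      = field_trace (d * (x ^ q ^ s * y + x * y ^ q ^ s))
        + field_trace (d * (x ^ q ^ s * z + x * z ^ q ^ s))"
    by (simp only: field_trace_add)
qed (blast intro: field_trace_in_Fq that)+

text \<open>
  Writing \<open>x\<close> and \<open>t\<close> as \<open>q ^ s\<close>-th powers removes the inverse Frobenius power from the second
  term of the binomial. Dependence of \<open>x\<close> and \<open>t\<close> would put \<open>x / t = v ^ q ^ s\<close> into \<open>Fq\<close>,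
  forcing \<open>v ^ q ^ s - v = 0\<close>.
\<close>

lemma not_scattered_of_witness:
  fixes \<delta> :: 'a
  assumes s: "coprime s n" "s > 0" and d: "d ^ q ^ s = \<delta> * d" and r: "r \<noteq> 0"
    and d_nz: "d \<noteq> 0" and v: "v ^ q ^ s - v = d * r ^ (q ^ s + 1)"
  shows "\<not> scattered Fq (LP_binomial n (q ^ s) \<delta>)"
proof
  assume scat: "scattered Fq (LP_binomial n (q ^ s) \<delta>)"
  let ?\<sigma> = "q ^ s"
  define u where "u = inverse r"
  let ?t = "u ^ ?\<sigma>" and ?x = "(u * v) ^ ?\<sigma>"
  have u: "u \<noteq> 0" "u * r = 1"
    using r by (simp_all add: u_def)
  (* ?\<sigma> ^ n is a power of q ^ n, whose power map is the identity; so raising to the power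
     ?\<sigma> ^ (n - 1) inverts raising to the power ?\<sigma>. *)
  have inv: "(y ^ ?\<sigma>) ^ ?\<sigma> ^ (n - 1) = y" for y :: 'a
  proof -
    have "?\<sigma> * ?\<sigma> ^ (n - 1) = (q ^ n) ^ s"
      using n_pos by (cases n) (auto simp: power_mult_distrib power_mult[symmetric] mult.commute)
    then show ?thesis
      using fixed_power_iterate[OF power_q_n] by (simp add: power_mult[symmetric])
  qed
  have f: "LP_binomial n ?\<sigma> \<delta> (y ^ ?\<sigma>) = (y ^ ?\<sigma>) ^ ?\<sigma> + \<delta> * y" for y :: 'a
    unfolding LP_binomial_def inv ..
  let ?a = "v ^ ?\<sigma> - v" and ?R = "r ^ ?\<sigma>"
  have a: "(v ^ ?\<sigma>) ^ ?\<sigma> - v ^ ?\<sigma> = \<delta> * d * (?R ^ ?\<sigma> * ?R)"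
    using arg_cong[OF v, of "\<lambda>z. z ^ ?\<sigma>"]
    by (simp add: power_q_diff power_mult_distrib d)
  have uR: "?t * ?R = 1" "?t ^ ?\<sigma> * ?R ^ ?\<sigma> = 1"
    using u(2) by (simp_all add: power_mult_distrib[symmetric])
  have "?t ^ ?\<sigma> * ((v ^ ?\<sigma>) ^ ?\<sigma> - v ^ ?\<sigma>) = (?t ^ ?\<sigma> * ?R ^ ?\<sigma>) * (\<delta> * d * ?R)"
    unfolding a by (simp add: mult_ac)
  also have "\<dots> = \<delta> * (u * r) * (d * ?R)"
    by (simp add: uR u)
  also have "\<dots> = \<delta> * u * ?a"
    unfolding v by (simp add: mult_ac)
  finally have "?x * LP_binomial n ?\<sigma> \<delta> ?t - ?t * LP_binomial n ?\<sigma> \<delta> ?x = 0"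
    unfolding f by (simp add: power_mult_distrib algebra_simps)
  then have "lin_dependent Fq ?x ?t"
    using scat by (auto simp: scattered_def)
  then obtain a b where ab: "a \<in> Fq" "b \<in> Fq" "(a, b) \<noteq> (0, 0)" "a * ?x + b * ?t = 0"
    by (auto simp: lin_dependent_def)
  then have "?t * (a * v ^ ?\<sigma> + b) = 0"
    by (simp add: power_mult_distrib algebra_simps)
  then have eq: "a * v ^ ?\<sigma> + b = 0"
    using u(1) by simp
  then have "a \<noteq> 0"
    using ab(3) by auto
  then have "v ^ ?\<sigma> = (- b) / a"
    using eq by (simp add: field_simps eq_neg_iff_add_eq_0)
  then have "v ^ ?\<sigma> \<in> Fq"
    using ab by (simp only: subfield_divide[OF subfield_Fq] subfield_uminus[OF subfield_Fq])
  then have "?a ^ ?\<sigma> = 0"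
    by (simp add: power_q_diff Fq_power_q)
  then show False
    using v d_nz r by simp
qed

end

theorem theorem3p4:
  fixes q n s \<sigma> :: nat
    and Fq :: "'a::{field, finite} set"
    and \<delta> :: 'a
  assumes "primepow q" and "n \<ge> 3" and "s \<ge> 1" and "coprime s n"
    and "\<sigma> = q ^ s"
    and "CARD('a) = q ^ n"
    and "is_subfield Fq" and "card Fq = q"
    and "field_norm q n \<delta> = 1"
  shows "\<not> scattered Fq (LP_binomial n \<sigma> \<delta>)"
proof -
  interpret finite_field_extension q n Fq
    using assms by unfold_locales auto
  have s: "coprime s n" "s > 0"
    using assms by auto
  obtain d where d: "d \<noteq> 0" "d ^ q ^ s = \<delta> * d"
    using multiplicative_Hilbert_90[OF s assms(9)] by blast
  obtain r where r: "r \<noteq> 0" "field_trace (d * r ^ (q ^ s + 1)) = 0"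
    using trace_form_has_isotropic_vector[OF assms(2)] by blast
  obtain v where "v ^ q ^ s - v = d * r ^ (q ^ s + 1)"
    using additive_Hilbert_90[OF s r(2)] by blast
  then show ?thesis
    using not_scattered_of_witness[OF s d(2) r(1) d(1)] assms(5) by simp
qed

end
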